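(* Let $R$ be a finite commutative ring with nonzero identity which is not a field, and let $n>1$ be an integer. Then $\gamma(TD(R,n))\leq |R\setminus U(R)|^2-1$.
   Context: $U(R)$ denotes the set of invertible elements of $R$. For a commutative ring $R$ with nonzero identity and an integer $n\ge1$, $TD(R,n)$ is the simple graph with vertex set $R^n\setminus\{(0,\ldots,0)\}$ in which two distinct vertices $\mathbf{x},\mathbf{y}$ are adjacent if and only if $\mathbf{x}\cdot\mathbf{y}=\sum_{i=1}^n x_iy_i=0$ in $R$. A set $D$ of vertices of a graph $G$ is dominating if every vertex of $V(G)\setminus D$ is adjacent to a vertex of $D$; the domination number $\gamma(G)$ is the minimum number of vertices of a dominating set of $G$. *)

theory Defs
  imports "HOL-Algebra.Algebra" "Graph_Theory.Pair_Digraph"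
begin

text \<open>Vectors in \<open>R\<^sup>n\<close> are the extensional functions on the index set \<open>{1..n}\<close>.\<close>

definition vecs :: "('a, 'm) ring_scheme \<Rightarrow> nat \<Rightarrow> (nat \<Rightarrow> 'a) set" where
  "vecs R n = {1..n} \<rightarrow>\<^sub>E carrier R"

definition zero_vec :: "('a, 'm) ring_scheme \<Rightarrow> nat \<Rightarrow> nat \<Rightarrow> 'a" where
  "zero_vec R n = (\<lambda>i\<in>{1..n}. \<zero>\<^bsub>R\<^esub>)"

definition dot :: "('a, 'm) ring_scheme \<Rightarrow> nat \<Rightarrow> (nat \<Rightarrow> 'a) \<Rightarrow> (nat \<Rightarrow> 'a) \<Rightarrow> 'a" where
  "dot R n x y = (\<Oplus>\<^bsub>R\<^esub>i\<in>{1..n}. x i \<otimes>\<^bsub>R\<^esub> y i)"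

text \<open>
  As usual in \<open>Graph_Theory\<close>, a simple graph is a symmetric loop-free digraph without
  parallel arcs: an edge is a pair of opposite arcs.
\<close>

definition TD :: "('a, 'm) ring_scheme \<Rightarrow> nat \<Rightarrow> (nat \<Rightarrow> 'a) pair_pre_digraph" where
  "TD R n =
     (let V = vecs R n - {zero_vec R n}
      in \<lparr> pverts = V,
           parcs = {(x, y). x \<in> V \<and> y \<in> V \<and> x \<noteq> y \<and> dot R n x y = \<zero>\<^bsub>R\<^esub>} \<rparr>)"

lemma TD_pair_graph:
  assumes "cring R" and "finite (carrier R)"
  shows "pair_graph (TD R n)"
proof -
  interpret cring R by fact
  have V: "finite (pverts (TD R n))"
    using assms(2) by (simp add: TD_def Let_def vecs_def finite_PiE)
  have A: "parcs (TD R n) \<subseteq> pverts (TD R n) \<times> pverts (TD R n)"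
    by (auto simp: TD_def Let_def)
  have comm: "dot R n x y = dot R n y x" if "x \<in> vecs R n" "y \<in> vecs R n" for x y
    unfolding dot_def using that
    by (intro finsum_cong') (auto simp: vecs_def PiE_iff m_comm)
  have "symmetric (TD R n)"
    unfolding symmetric_def with_proj_simps
    by (rule symI) (auto simp: TD_def Let_def comm)
  moreover have "finite (parcs (TD R n))"
    using V A finite_subset by blast
  ultimately show ?thesis
    using V A by unfold_locales (auto simp: TD_def Let_def)
qed

text \<open>
  The following two notions are meant for symmetric digraphs, where \<open>u \<rightarrow>\<^bsub>G\<^esub> v\<close> is adjacency.
\<close>

definition dominating_set :: "('v, 'e) pre_digraph \<Rightarrow> 'v set \<Rightarrow> bool" where
  "dominating_set G D \<longleftrightarrow> D \<subseteq> verts G \<and> (\<forall>v \<in> verts G - D. \<exists>u \<in> D. u \<rightarrow>\<^bsub>G\<^esub> v)"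

text \<open>Finiteness is required below because \<open>card\<close> is \<open>0\<close> on infinite sets.\<close>

definition domination_number :: "('v, 'e) pre_digraph \<Rightarrow> nat" where
  "domination_number G = (LEAST k. \<exists>D. dominating_set G D \<and> finite D \<and> card D = k)"

end

theory Submission
  imports Defs
begin

text \<open>
  Let \<open>Z\<close> be the set of non-units of \<open>R\<close>. The vectors \<open>(a, b, 0, \<dots>, 0) \<noteq> 0\<close> with \<open>a, b \<in> Z\<close>
  form a dominating set, and there are \<open>|Z|\<^sup>2 - 1\<close> of them. Only the first two coordinates
  \<open>v\<^sub>1, v\<^sub>2\<close> of a vertex \<open>v\<close> enter its products with such vectors, and \<open>(v\<^sub>2, -v\<^sub>1)\<close> is orthogonal
  to \<open>(v\<^sub>1, v\<^sub>2)\<close>. The only obstructions are that this pair may vanish or may have a unit entry.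
  Because \<open>R\<close> is not a field, there is a nonzero non-unit \<open>z\<close>. If the pair vanishes, \<open>(z, 0)\<close>
  replaces it. If it has a unit entry, it is scaled by \<open>z\<close>: the entries become non-units, since a
  factor of a unit is a unit, and the pair stays nonzero, since a unit does not annihilate \<open>z\<close>.
  Edges join distinct vertices only, but a vertex that equals the vector chosen for it already lies
  in the set.
\<close>

definition pad :: "('a, 'm) ring_scheme \<Rightarrow> nat \<Rightarrow> 'a \<Rightarrow> 'a \<Rightarrow> nat \<Rightarrow> 'a" where
  "pad R n a b = (\<lambda>i\<in>{1..n}. if i = 1 then a else if i = 2 then b else \<zero>\<^bsub>R\<^esub>)"

lemma pad_in_vecs:
  assumes "cring R" "a \<in> carrier R" "b \<in> carrier R"
  shows "pad R n a b \<in> vecs R n"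
proof -
  interpret cring R by fact
  show ?thesis using assms(2,3) by (auto simp: pad_def vecs_def)
qed

lemma pad_eq_zero_vec_iff:
  assumes "n > 1"
  shows "pad R n a b = zero_vec R n \<longleftrightarrow> a = \<zero>\<^bsub>R\<^esub> \<and> b = \<zero>\<^bsub>R\<^esub>"
proof
  assume eq: "pad R n a b = zero_vec R n"
  show "a = \<zero>\<^bsub>R\<^esub> \<and> b = \<zero>\<^bsub>R\<^esub>"
    using assms fun_cong[OF eq, of 1] fun_cong[OF eq, of 2] by (simp add: pad_def zero_vec_def)
qed (auto simp: pad_def zero_vec_def)

lemma dot_pad:
  assumes "cring R" "n > 1" "a \<in> carrier R" "b \<in> carrier R" "v \<in> vecs R n"
  shows "dot R n (pad R n a b) v = a \<otimes>\<^bsub>R\<^esub> v 1 \<oplus>\<^bsub>R\<^esub> b \<otimes>\<^bsub>R\<^esub> v 2"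
proof -
  interpret cring R by fact
  have v: "v i \<in> carrier R" if "i \<in> {1..n}" for i
    using assms(5) that by (auto simp: vecs_def PiE_iff)
  have split: "{1..n} = insert 1 (insert 2 {3..n})" using assms(2) by auto
  have tail: "(\<Oplus>\<^bsub>R\<^esub>i\<in>{3..n}. pad R n a b i \<otimes>\<^bsub>R\<^esub> v i) = \<zero>\<^bsub>R\<^esub>"
    using v by (intro add.finprod_one_eqI) (auto simp: pad_def)
  have "dot R n (pad R n a b) v
      = pad R n a b 1 \<otimes>\<^bsub>R\<^esub> v 1 \<oplus>\<^bsub>R\<^esub> (pad R n a b 2 \<otimes>\<^bsub>R\<^esub> v 2 \<oplus>\<^bsub>R\<^esub> (\<Oplus>\<^bsub>R\<^esub>i\<in>{3..n}. pad R n a b i \<otimes>\<^bsub>R\<^esub> v i))"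
    unfolding dot_def split
    using assms v by (subst finsum_insert; (subst finsum_insert)?) (auto simp: pad_def)
  also have "\<dots> = a \<otimes>\<^bsub>R\<^esub> v 1 \<oplus>\<^bsub>R\<^esub> b \<otimes>\<^bsub>R\<^esub> v 2"
    unfolding tail using assms v by (simp add: pad_def)
  finally show ?thesis .
qed

lemma (in cring) ex_nonzero_nonunit:
  assumes "\<one> \<noteq> \<zero>" "\<not> field R"
  obtains z where "z \<in> carrier R - Units R" "z \<noteq> \<zero>"
proof -
  have "Units R \<noteq> carrier R - {\<zero>}" using assms(2) cring_fieldI by blast
  moreover have "\<zero> \<notin> Units R"
    using assms(1) Units_r_inv[of \<zero>] Units_inv_closed[of \<zero>] by (metis l_null)
  then have "Units R \<subseteq> carrier R - {\<zero>}" using Units_closed by blast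
  ultimately show thesis using that by blast
qed

lemma (in cring) nonunit_mult:
  assumes "a \<in> carrier R - Units R" "b \<in> carrier R"
  shows "a \<otimes> b \<in> carrier R - Units R"
  using assms unit_factor by blast

lemma (in cring) nonunit_minus:
  assumes "a \<in> carrier R - Units R"
  shows "\<ominus> a \<in> carrier R - Units R"
  using nonunit_mult[OF assms, of "\<ominus> \<one>"] assms by (simp add: r_minus)

lemma (in cring) nonzero_mult_unit:
  assumes "z \<in> carrier R" "z \<noteq> \<zero>" "x \<in> Units R"
  shows "z \<otimes> x \<noteq> \<zero>"
proof
  assume "z \<otimes> x = \<zero>"
  then have "z \<otimes> x \<otimes> inv x = \<zero>" using assms by simp
  then show False using assms by (simp add: m_assoc Units_closed)
qed

text \<open>
  The witness is \<open>(y, -x)\<close> whenever this pair is nonzero with non-unit entries. Otherwise a nonzero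
  non-unit \<open>z\<close> repairs it: \<open>(z, 0)\<close> serves if \<open>x = y = 0\<close>, and \<open>(zy, -zx)\<close> if \<open>x\<close> or \<open>y\<close> is a unit.
\<close>

lemma (in cring) ex_orthogonal_nonunit_pair:
  assumes "\<one> \<noteq> \<zero>" "\<not> field R" and xy: "x \<in> carrier R" "y \<in> carrier R"
  obtains a b where "a \<in> carrier R - Units R" "b \<in> carrier R - Units R" "(a, b) \<noteq> (\<zero>, \<zero>)"
    and "a \<otimes> x \<oplus> b \<otimes> y = \<zero>"
proof -
  obtain z where z: "z \<in> carrier R - Units R" "z \<noteq> \<zero>"
    using ex_nonzero_nonunit assms(1,2) by blast
  then have zc: "z \<in> carrier R" by blast
  consider (vanish) "x = \<zero>" "y = \<zero>" | (unit) "x \<in> Units R \<or> y \<in> Units R"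
    | (nonunit) "x \<in> carrier R - Units R" "y \<in> carrier R - Units R" "(x, y) \<noteq> (\<zero>, \<zero>)"
    using xy by blast
  then show thesis
  proof cases
    case vanish
    have "\<zero> \<in> carrier R - Units R" using nonunit_mult[OF z(1) zero_closed] zc by simp
    then show thesis using that[of z \<zero>] vanish z zc by simp
  next
    case unit
    have "z \<otimes> y \<noteq> \<zero> \<or> z \<otimes> x \<noteq> \<zero>" using unit nonzero_mult_unit[OF zc z(2)] by blast
    moreover have "\<ominus> (z \<otimes> x) = \<zero> \<longrightarrow> z \<otimes> x = \<zero>" using zc xy by (metis m_closed minus_minus minus_zero)
    moreover have "z \<otimes> y \<otimes> x \<oplus> \<ominus> (z \<otimes> x) \<otimes> y = \<zero>"
      using zc xy by (simp add: l_minus m_assoc m_comm[of y x] r_neg)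
    ultimately show thesis
      using that[of "z \<otimes> y" "\<ominus> (z \<otimes> x)"] nonunit_mult[OF z(1)] nonunit_minus xy by blast
  next
    case nonunit
    have "\<ominus> x = \<zero> \<longrightarrow> x = \<zero>" using xy by (metis minus_minus minus_zero)
    moreover have "y \<otimes> x \<oplus> \<ominus> x \<otimes> y = \<zero>"
      using xy by (simp add: l_minus m_comm[of y x] r_neg)
    ultimately show thesis
      using that[of y "\<ominus> x"] nonunit nonunit_minus[OF nonunit(1)] by blast
  qed
qed

lemma domination_number_le_card:
  assumes "dominating_set G D" "finite D"
  shows "domination_number G \<le> card D"
  unfolding domination_number_def using assms by (intro Least_le) blast

theorem theorem3p3:
  fixes R :: "('a, 'm) ring_scheme" and n :: nat
  assumes "cring R"
    and "\<one>\<^bsub>R\<^esub> \<noteq> \<zero>\<^bsub>R\<^esub>"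
    and "finite (carrier R)"
    and "\<not> field R"
    and "n > 1"
  shows "domination_number (with_proj (TD R n)) \<le> (card (carrier R - Units R))\<^sup>2 - 1"
proof -
  interpret cring R by fact
  define Z where "Z = carrier R - Units R"
  define P where "P = Z \<times> Z - {(\<zero>\<^bsub>R\<^esub>, \<zero>\<^bsub>R\<^esub>)}"
  define D where "D = (\<lambda>(a, b). pad R n a b) ` P"
  have finZ: "finite Z" using assms(3) by (simp add: Z_def)
  then have finP: "finite P" by (simp add: P_def)
  have zero: "\<zero>\<^bsub>R\<^esub> \<in> Z"
  proof -
    obtain z where "z \<in> carrier R - Units R" using ex_nonzero_nonunit assms(2,4) by blast
    then show ?thesis using nonunit_mult[of z "\<zero>\<^bsub>R\<^esub>"] by (simp add: Z_def)
  qed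
  have verts: "pverts (TD R n) = vecs R n - {zero_vec R n}"
    by (simp add: TD_def Let_def)
  have D_verts: "D \<subseteq> pverts (TD R n)"
    using assms(1,5) by (auto simp: D_def P_def Z_def verts pad_in_vecs pad_eq_zero_vec_iff)
  have "dominating_set (with_proj (TD R n)) D"
    unfolding dominating_set_def
  proof (intro conjI ballI)
    show "D \<subseteq> verts (with_proj (TD R n))" using D_verts by simp
  next
    fix v assume "v \<in> verts (with_proj (TD R n)) - D"
    then have v: "v \<in> pverts (TD R n)" "v \<notin> D" by simp_all
    then have vec: "v \<in> vecs R n" by (simp add: verts)
    then have "v 1 \<in> carrier R" "v 2 \<in> carrier R"
      using assms(5) by (auto simp: vecs_def PiE_iff)
    then obtain a b where ab: "a \<in> Z" "b \<in> Z" "(a, b) \<noteq> (\<zero>\<^bsub>R\<^esub>, \<zero>\<^bsub>R\<^esub>)" "a \<otimes>\<^bsub>R\<^esub> v 1 \<oplus>\<^bsub>R\<^esub> b \<otimes>\<^bsub>R\<^esub> v 2 = \<zero>\<^bsub>R\<^esub>"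
      using ex_orthogonal_nonunit_pair[OF assms(2,4)] unfolding Z_def by metis
    have "dot R n (pad R n a b) v = \<zero>\<^bsub>R\<^esub>"
      using dot_pad[OF assms(1,5) _ _ vec] ab by (simp add: Z_def)
    moreover have u: "pad R n a b \<in> D" using ab unfolding D_def P_def by force
    ultimately have "(pad R n a b, v) \<in> parcs (TD R n)"
      using v D_verts by (auto simp: TD_def Let_def)
    then show "\<exists>u\<in>D. u \<rightarrow>\<^bsub>with_proj (TD R n)\<^esub> v" using u by (auto simp: arcs_ends_def arc_to_ends_def)
  qed
  then have "domination_number (with_proj (TD R n)) \<le> card D"
    using finP by (intro domination_number_le_card) (simp_all add: D_def)
  also have "\<dots> \<le> card P" unfolding D_def using finP by (rule card_image_le)
  also have "\<dots> = (card Z)\<^sup>2 - 1"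
    using zero finZ by (simp add: P_def card_cartesian_product power2_eq_square)
  finally show ?thesis by (simp add: Z_def)
qed

end
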